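(* Let $d\ge 2$ and consider first-passage percolation on $\mathbb{Z}^d$ with i.i.d. non-negative edge passage times $(\tau(e))_{e\in\mathcal{E}}$. Let $S_-$ and $S_+$ be the infimum and supremum of the support of the common distribution of the $\tau(e)$. Assume $0<S_-$ and $S_+\le 2S_-$. Then for every integer $n\ge 1$, $$a(n)\ \ge\ a(n-1)+S_-\left[1-\frac{(S_+-S_-)^2}{S_-^2}\right].$$ In particular the sequence $(a(n))_{n\ge 0}$ is non-decreasing.
   Context: $\mathbb{Z}^d$ is viewed as a graph with vertex set $\mathbb{Z}^d$ and an (unoriented) edge between two vertices at Euclidean distance $1$; $\mathcal{E}$ is its edge set. A path from $a$ to $b$ is a finite sequence of vertices $r=(a=x_0,\dots,x_k=b)$ with $x_i,x_{i+1}$ adjacent for all $i$; its passage time is $\tau(r)=\sum_{i=0}^{k-1}\tau(x_i,x_{i+1})$. The passage time from $a$ to $b$ is $T(a,b)=\inf\{\tau(r): r \text{ a path from } a \text{ to } b\}$. Let $e_1,\dots,e_d$ be the canonical basis of $\mathbb{R}^d$, and $a(n)=E(T(0,ne_1))$. *)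

theory Defs
  imports "HOL-Probability.Probability"
begin

text \<open>Vertices of Z^d are integer lists of length d. Coordinate index 0 plays the role of e_1.\<close>

definition vertices :: "nat \<Rightarrow> int list set" where
  "vertices d = {x. length x = d}"

definition adjacent :: "nat \<Rightarrow> int list \<Rightarrow> int list \<Rightarrow> bool" where
  "adjacent d x y \<longleftrightarrow> length x = d \<and> length y = d \<and>
     (\<exists>i<d. y = x[i := x ! i + 1] \<or> x = y[i := y ! i + 1])"

definition edges :: "nat \<Rightarrow> int list set set" where
  "edges d = {{x, y} | x y. adjacent d x y}"

definition is_path :: "nat \<Rightarrow> int list \<Rightarrow> int list \<Rightarrow> int list list \<Rightarrow> bool" where
  "is_path d a b r \<longleftrightarrow> r \<noteq> [] \<and> hd r = a \<and> last r = b \<and>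
     (\<forall>i. Suc i < length r \<longrightarrow> adjacent d (r ! i) (r ! Suc i))"

definition path_time :: "(int list set \<Rightarrow> real) \<Rightarrow> int list list \<Rightarrow> real" where
  "path_time t r = (\<Sum>i<length r - 1. t {r ! i, r ! Suc i})"

definition passage_time :: "nat \<Rightarrow> (int list set \<Rightarrow> real) \<Rightarrow> int list \<Rightarrow> int list \<Rightarrow> real" where
  "passage_time d t a b = Inf {path_time t r | r. is_path d a b r}"

definition origin :: "nat \<Rightarrow> int list" where
  "origin d = replicate d 0"

definition ne1 :: "nat \<Rightarrow> nat \<Rightarrow> int list" where
  "ne1 d n = (replicate d 0)[0 := int n]"

definition real_support :: "real measure \<Rightarrow> real set" where
  "real_support mu = {x. \<forall>\<epsilon>>0. measure mu {x - \<epsilon> <..< x + \<epsilon>} > 0}"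

definition mean_time :: "'a measure \<Rightarrow> nat \<Rightarrow> (int list set \<Rightarrow> 'a \<Rightarrow> real) \<Rightarrow> nat \<Rightarrow> real" where
  "mean_time M d tau n = (\<integral>\<omega>. passage_time d (\<lambda>e. tau e \<omega>) (origin d) (ne1 d n) \<partial>M)"

end

theory Submission
  imports Defs
begin

text \<open>
  For 0 \<le> k < n, delete from the environment the edges joining the hyperplanes x_1 = k and
  x_1 = k + 1 together with the edges inside x_1 = k + 1, and glue the two sides. The new
  environment has the law of the old one, and a path from 0 to n e_1 collapses to a path from 0
  to (n - 1) e_1. This saves at least S_- for each deleted crossing edge and costs at most
  S_+ - S_- for each step inside the deleted hyperplane. Summed over k, a path of length L with h
  crossing edges in the slabs 0, ..., n - 1 changes by at most -S_- h + (S_+ - S_-)(L - h).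
  Here h \<ge> n, and a path which is no slower than the straight line has L S_- \<le> n S_+; so the
  average saving over k is at least S_- - (S_+ - S_-)^2 / S_-.
\<close>

section \<open>Deleting one layer of the lattice\<close>

definition shift1 :: "int list \<Rightarrow> int list" where
  "shift1 x = x[0 := x ! 0 + 1]"

text \<open>
  The edge of the original environment whose passage time the glued environment assigns to e.
\<close>

definition dup_layer :: "int \<Rightarrow> int list set \<Rightarrow> int list set" where
  "dup_layer k e = (if \<forall>x\<in>e. x ! 0 \<le> k then e else shift1 ` e)"

definition collapse :: "int \<Rightarrow> int list \<Rightarrow> int list" where
  "collapse k x = (if x ! 0 \<le> k then x else x[0 := x ! 0 - 1])"

text \<open>
  Upper bound for the increase in the passage time of the step from x to y when the path is
  collapsed at level k.
\<close>

definition collapse_cost :: "real \<Rightarrow> real \<Rightarrow> int \<Rightarrow> int list \<Rightarrow> int list \<Rightarrow> real" where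
  "collapse_cost lo hi k x y =
     (if x ! 0 = y ! 0 then (if x ! 0 = k + 1 then hi - lo else 0)
      else (if min (x ! 0) (y ! 0) = k then - lo else 0))"

lemma adjacent_shift:
  assumes "adjacent d x y"
  shows "adjacent d (x[0 := x ! 0 + c]) (y[0 := y ! 0 + c])"
proof -
  have *: "y[0 := y ! 0 + c] = (x[0 := x ! 0 + c])[i := x[0 := x ! 0 + c] ! i + 1]"
    if "y = x[i := x ! i + 1]" "i < length x" for x y :: "int list" and i
    using that by (cases "i = 0") (auto simp: list_update_swap algebra_simps)
  obtain i where i: "i < d" "length x = d" "length y = d"
      and "y = x[i := x ! i + 1] \<or> x = y[i := y ! i + 1]"
    using assms unfolding adjacent_def by blast
  then show ?thesis
    unfolding adjacent_def using *[of y x i] *[of x y i] by auto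
qed

lemma adjacent_first_coord:
  assumes "adjacent d x y"
  shows "x ! 0 = y ! 0 \<or> y = x[0 := x ! 0 + 1] \<or> x = y[0 := y ! 0 + 1]"
  using assms unfolding adjacent_def by (metis nth_list_update_neq)

lemma adjacent_length: "adjacent d x y \<Longrightarrow> length x = d \<and> length y = d \<and> 0 < d"
  unfolding adjacent_def by auto

lemma edge_of_adjacent: "adjacent d x y \<Longrightarrow> {x, y} \<in> edges d"
  unfolding edges_def by blast

lemma countable_edges: "countable (edges d)"
proof -
  have "edges d \<subseteq> (\<lambda>(x, y). {x, y}) ` (UNIV :: (int list \<times> int list) set)"
    unfolding edges_def by auto
  then show ?thesis by (rule countable_subset) simp
qed

lemma dup_layer_edges: "e \<in> edges d \<Longrightarrow> dup_layer k e \<in> edges d"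
  unfolding dup_layer_def edges_def shift1_def
  by (auto dest: adjacent_shift[where c = 1])

lemma edge_vertex_length: "e \<in> edges d \<Longrightarrow> x \<in> e \<Longrightarrow> length x = d \<and> 0 < d"
  unfolding edges_def using adjacent_length by auto

lemma inj_on_shift1: "inj_on shift1 {x. length x = d \<and> 0 < d}"
proof (rule inj_onI)
  fix x y assume *: "x \<in> {x. length x = d \<and> 0 < d}" "y \<in> {x. length x = d \<and> 0 < d}"
    and eq: "shift1 x = shift1 y"
  obtain a u b v where "x = a # u" "y = b # v"
    using * by (cases x; cases y; auto)
  with eq show "x = y" by (simp add: shift1_def)
qed

text \<open>A moved edge has a vertex above level \<open>k\<close>, and shifting raises that vertex
  further, so the moved edge never meets an edge left in place; among moved edges the shift is
  injective. Hence the glued environment reads distinct edges of an i.i.d. family, which is what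
  preserves its law.\<close>

lemma inj_on_dup_layer: "inj_on (dup_layer k) (edges d)"
proof (rule inj_onI)
  have *: False if "e \<in> edges d" "\<not> (\<forall>x\<in>e. x ! 0 \<le> k)" "\<forall>x\<in>shift1 ` e. x ! 0 \<le> k" for e
    using that edge_vertex_length[of e d] unfolding shift1_def by fastforce
  fix e f assume e: "e \<in> edges d" and f: "f \<in> edges d" and eq: "dup_layer k e = dup_layer k f"
  have "e \<subseteq> {x. length x = d \<and> 0 < d}" "f \<subseteq> {x. length x = d \<and> 0 < d}"
    using edge_vertex_length e f by auto
  then have "shift1 ` e = shift1 ` f \<Longrightarrow> e = f"
    using inj_on_image_eq_iff[OF inj_on_shift1] by blast
  then show "e = f"
    using eq *[OF e] *[OF f] unfolding dup_layer_def by (auto split: if_splits)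
qed

text \<open>A step crossing from level \<open>k\<close> to \<open>k + 1\<close> contracts to a
  point, and dropping it saves at least \<open>lo\<close>. Every other step stays a step, and the
  glued environment charges it its old passage time, except when it runs inside hyperplane
  \<open>k + 1\<close>.\<close>

lemma collapse_step:
  assumes adj: "adjacent d x y"
    and t: "\<And>e. e \<in> edges d \<Longrightarrow> lo \<le> t e \<and> t e \<le> hi"
  shows "(collapse k x = collapse k y \<and> 0 \<le> t {x, y} + collapse_cost lo hi k x y) \<or>
    (adjacent d (collapse k x) (collapse k y) \<and>
      t (dup_layer k {collapse k x, collapse k y}) \<le> t {x, y} + collapse_cost lo hi k x y)"
proof -
  have len: "length x = d" "length y = d" "0 < d"
    using adjacent_length[OF adj] by auto
  have txy: "lo \<le> t {x, y}" "t {x, y} \<le> hi"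
    using t edge_of_adjacent[OF adj] by auto
  consider (low) "x ! 0 \<le> k" "y ! 0 \<le> k" | (high) "k < x ! 0" "k < y ! 0"
    | (up) "x ! 0 \<le> k" "k < y ! 0" | (down) "k < x ! 0" "y ! 0 \<le> k"
    by linarith
  then show ?thesis
  proof cases
    case low
    have "\<bar>y ! 0 - x ! 0\<bar> \<le> 1"
      using adjacent_first_coord[OF adj] len by (elim disjE) (simp_all add: nth_list_update)
    then have "min (x ! 0) (y ! 0) \<noteq> k" if "x ! 0 \<noteq> y ! 0"
      using low that by linarith
    then have "collapse_cost lo hi k x y = 0"
      using low by (simp add: collapse_cost_def)
    then show ?thesis
      using low adj by (simp add: collapse_def dup_layer_def)
  next
    case high
    have c: "collapse k x = x[0 := x ! 0 - 1]" "collapse k y = y[0 := y ! 0 - 1]"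
      using high by (auto simp: collapse_def)
    have adj': "adjacent d (collapse k x) (collapse k y)"
      using adjacent_shift[OF adj, of "-1"] c by simp
    have t': "t {collapse k x, collapse k y} \<le> hi"
      using t edge_of_adjacent[OF adj'] by auto
    have shift_back: "shift1 ` {collapse k x, collapse k y} = {x, y}"
      using len by (simp add: c shift1_def)
    show ?thesis
    \<comment> \<open>An edge inside hyperplane \<open>k + 1\<close> lands in hyperplane
      \<open>k\<close>, where \<open>dup_layer\<close> reads the image edge and not the one
      traversed. The two times are related only through \<open>lo\<close> and
      \<open>hi\<close>.\<close>
    proof (cases "x ! 0 = k + 1 \<and> y ! 0 = k + 1")
      case True
      then have "dup_layer k {collapse k x, collapse k y} = {collapse k x, collapse k y}"
        using len by (simp add: c dup_layer_def)
      then show ?thesis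
        using adj' t' txy True by (simp add: collapse_cost_def)
    next
      case False
      then have "\<not> (\<forall>v\<in>{collapse k x, collapse k y}. v ! 0 \<le> k)"
        using high len by (auto simp: c)
      then have "dup_layer k {collapse k x, collapse k y} = {x, y}"
        unfolding dup_layer_def using shift_back by (simp only: if_False)
      moreover have "0 \<le> collapse_cost lo hi k x y"
        using high txy by (auto simp: collapse_cost_def)
      ultimately show ?thesis
        using adj' by simp
    qed
  next
    case up
    have y: "y = x[0 := x ! 0 + 1]"
      using adjacent_first_coord[OF adj] len up
      by (elim disjE) (simp_all add: nth_list_update)
    then have "y ! 0 = x ! 0 + 1" using len by simp
    then show ?thesis
      using up y txy by (simp add: collapse_def collapse_cost_def)
  next
    case down
    have x: "x = y[0 := y ! 0 + 1]"
      using adjacent_first_coord[OF adj] len down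
      by (elim disjE) (simp_all add: nth_list_update)
    then have "x ! 0 = y ! 0 + 1" using len by simp
    then show ?thesis
      using down x txy by (simp add: collapse_def collapse_cost_def)
  qed
qed

section \<open>Paths and passage times\<close>

lemma is_path_single: "is_path d a b [x] \<longleftrightarrow> x = a \<and> x = b"
  unfolding is_path_def by auto

lemma is_path_Cons:
  "is_path d a b (x # y # r) \<longleftrightarrow> x = a \<and> adjacent d x y \<and> is_path d y b (y # r)"
  unfolding is_path_def by (auto simp: nth_Cons split: nat.splits)

lemma path_time_Cons: "path_time t (x # y # r) = t {x, y} + path_time t (y # r)"
  unfolding path_time_def by (simp add: sum.lessThan_Suc_shift del: sum.lessThan_Suc)

lemma path_edge:
  assumes "is_path d a b r" "i < length r - 1"
  shows "adjacent d (r ! i) (r ! Suc i)"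
  using assms unfolding is_path_def by auto

lemma path_time_nonneg:
  assumes "is_path d a b r" "\<And>e. e \<in> edges d \<Longrightarrow> 0 \<le> t e"
  shows "0 \<le> path_time t r"
  unfolding path_time_def 
  by (intro sum_nonneg assms(2) edge_of_adjacent path_edge[OF assms(1)]) simp

lemma path_time_cong:
  assumes "is_path d a b r" "\<And>e. e \<in> edges d \<Longrightarrow> t e = t' e"
  shows "path_time t r = path_time t' r"
  unfolding path_time_def 
  by (intro sum.cong refl assms(2) edge_of_adjacent path_edge[OF assms(1)]) simp

lemma passage_time_cong:
  assumes "\<And>e. e \<in> edges d \<Longrightarrow> t e = t' e"
  shows "passage_time d t a b = passage_time d t' a b"
proof -
  have "path_time t r = path_time t' r" if "is_path d a b r" for r
    using that assms by (rule path_time_cong)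
  then have "{path_time t r |r. is_path d a b r} = {path_time t' r |r. is_path d a b r}"
    by metis
  then show ?thesis by (simp add: passage_time_def)
qed

lemma passage_time_le:
  assumes "is_path d a b r" "\<And>e. e \<in> edges d \<Longrightarrow> 0 \<le> t e"
  shows "passage_time d t a b \<le> path_time t r"
  unfolding passage_time_def
proof (rule cInf_lower)
  show "bdd_below {path_time t r |r. is_path d a b r}"
    by (rule bdd_belowI[of _ 0]) (use assms(2) path_time_nonneg in blast)
qed (use assms in blast)

text \<open>Besides yielding the upper bound \<open>n * hi\<close>, this path makes the set under
  the infimum nonempty, and with \<open>n = 1\<close> it exhibits an edge of the lattice.\<close>

lemma straight_path:
  assumes "0 < d"
  shows "is_path d (origin d) (ne1 d n) (map (ne1 d) [0..<Suc n])"
proof -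
  have "adjacent d (ne1 d i) (ne1 d (Suc i))" for i
    unfolding adjacent_def ne1_def using assms by (auto intro!: exI[of _ 0] simp: add.commute)
  moreover have "ne1 d 0 = origin d"
    unfolding ne1_def origin_def using assms by (cases d) auto
  ultimately show ?thesis
    unfolding is_path_def by (auto simp: hd_map last_map simp del: upt_Suc)
qed

lemma straight_path_time_le:
  assumes "0 < d" "\<And>e. e \<in> edges d \<Longrightarrow> t e \<le> hi"
  shows "path_time t (map (ne1 d) [0..<Suc n]) \<le> n * hi"
proof -
  let ?r = "map (ne1 d) [0..<Suc n]"
  have "path_time t ?r \<le> (\<Sum>i<length ?r - 1. hi)"
    unfolding path_time_def
    by (intro sum_mono assms(2) edge_of_adjacent path_edge[OF straight_path[OF assms(1)]]) auto
  then show ?thesis by simp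
qed

lemma passage_time_bounds:
  assumes "0 < d" "\<And>e. e \<in> edges d \<Longrightarrow> 0 \<le> t e \<and> t e \<le> hi"
  shows "0 \<le> passage_time d t (origin d) (ne1 d n)"
    and "passage_time d t (origin d) (ne1 d n) \<le> n * hi"
proof -
  note sp = straight_path[OF assms(1), of n]
  show "0 \<le> passage_time d t (origin d) (ne1 d n)"
    unfolding passage_time_def using sp assms(2)
    by (intro cInf_greatest) (auto intro: path_time_nonneg)
  show "passage_time d t (origin d) (ne1 d n) \<le> n * hi"
    using passage_time_le[OF sp, of t] straight_path_time_le[OF assms(1), of t hi n] assms(2)
    by fastforce
qed

section \<open>Collapsing paths and counting crossings\<close>

lemma path_image:
  assumes step: "\<And>x y. adjacent d x y \<Longrightarrow> (f x = f y \<and> 0 \<le> w x y) \<or>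
      (adjacent d (f x) (f y) \<and> t {f x, f y} \<le> w x y)"
  shows "is_path d a b r \<Longrightarrow> \<exists>r'. is_path d (f a) (f b) r' \<and>
      path_time t r' \<le> (\<Sum>i<length r - 1. w (r ! i) (r ! Suc i) :: real)"
proof (induction r arbitrary: a rule: induct_list012)
  case 1
  then show ?case by (simp add: is_path_def)
next
  case (2 x)
  then have "is_path d (f a) (f b) [f x]"
    by (auto simp: is_path_single)
  then show ?case
    by (intro exI[of _ "[f x]"]) (simp add: path_time_def)
next
  case (3 x y r)
  from 3(3) have x: "x = a" and adj: "adjacent d x y" and p: "is_path d y b (y # r)"
    by (auto simp: is_path_Cons)
  obtain r' where r': "is_path d (f y) (f b) r'"
      "path_time t r' \<le> (\<Sum>i<length (y # r) - 1. w ((y # r) ! i) ((y # r) ! Suc i))"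
    using 3(2)[OF p] by blast
  have sum: "(\<Sum>i<length (x # y # r) - 1. w ((x # y # r) ! i) ((x # y # r) ! Suc i))
      = w x y + (\<Sum>i<length (y # r) - 1. w ((y # r) ! i) ((y # r) ! Suc i))"
    by (simp add: sum.lessThan_Suc_shift del: sum.lessThan_Suc)
  from step[OF adj] show ?case
  proof
    assume "f x = f y \<and> 0 \<le> w x y"
    then show ?case using r' x unfolding sum by (intro exI[of _ r']) auto
  next
    assume *: "adjacent d (f x) (f y) \<and> t {f x, f y} \<le> w x y"
    obtain s where s: "r' = f y # s"
      using r'(1) unfolding is_path_def by (cases r') auto
    show ?case unfolding sum
      by (rule exI[of _ "f x # r'"]) (use * r' x s in \<open>auto simp: is_path_Cons path_time_Cons\<close>)
  qed
qed

text \<open>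
  Along a step, the clamped coordinate changes by one exactly when the step crosses one of the
  slabs 0, ..., n - 1, so telescoping gives at least n crossings.
\<close>

definition clamp1 :: "nat \<Rightarrow> int list \<Rightarrow> int" where
  "clamp1 n x = max 0 (min (x ! 0) (int n))"

text \<open>At most one level \<open>k\<close> sees a given step. The right side is one affine
  expression for both kinds of step: it equals \<open>- lo\<close> when the clamped coordinate moves
  and \<open>hi - lo\<close> when it does not, the latter also covering crossings outside the slabs,
  whose cost is 0.\<close>

lemma sum_collapse_cost_le:
  assumes adj: "adjacent d x y" and lohi: "0 \<le> lo" "lo \<le> hi"
  shows "(\<Sum>k<n. collapse_cost lo hi (int k) x y)
    \<le> (hi - lo) - hi * real_of_int \<bar>clamp1 n y - clamp1 n x\<bar>"
proof -
  have len: "length x = d" "length y = d" "0 < d"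
    using adjacent_length[OF adj] by auto
  consider (eq) "x ! 0 = y ! 0" | (ne) "x ! 0 \<noteq> y ! 0" "\<bar>y ! 0 - x ! 0\<bar> = 1"
    using adjacent_first_coord[OF adj] len by fastforce
  then show ?thesis
  proof cases
    case eq
    \<comment> \<open>The guard \<open>1 \<le> x ! 0\<close> is there because \<open>nat\<close>
      sends negative numbers to 0 and would wrongly select \<open>k = 0\<close>.\<close>
    have "(\<Sum>k<n. collapse_cost lo hi (int k) x y)
        = (\<Sum>k<n. if k = nat (x ! 0 - 1) then (if 1 \<le> x ! 0 then hi - lo else 0) else 0)"
      using eq by (intro sum.cong) (auto simp: collapse_cost_def)
    also have "\<dots> \<le> hi - lo"
      using lohi by (simp add: sum.delta)
    finally show ?thesis using eq by (simp add: clamp1_def)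
  next
    case ne
    define m where "m = min (x ! 0) (y ! 0)"
    have "(\<Sum>k<n. collapse_cost lo hi (int k) x y)
        = (\<Sum>k<n. if k = nat m then (if 0 \<le> m then - lo else 0) else 0)"
      using ne by (intro sum.cong) (auto simp: collapse_cost_def m_def)
    also have "\<dots> = (if 0 \<le> m \<and> m < int n then - lo else 0)"
      by (simp add: sum.delta nat_less_iff)
    finally have s: "(\<Sum>k<n. collapse_cost lo hi (int k) x y)
        = (if 0 \<le> m \<and> m < int n then - lo else 0)" .
    have "\<bar>clamp1 n y - clamp1 n x\<bar> = (if 0 \<le> m \<and> m < int n then 1 else 0)"
      using ne unfolding clamp1_def m_def by auto
    then show ?thesis using s lohi by auto
  qed
qed

text \<open>Summing the collapse bounds over \<open>k\<close> leaves the error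
  \<open>L * (hi - lo) - hi * H\<close>, where \<open>L\<close> is the number of steps and
  \<open>H\<close> the number of crossings. It remains to use that \<open>H\<close> is at least
  \<open>n\<close> and that a short path has few steps.\<close>

lemma collapsed_passage_times_le:
  assumes d: "0 < d" and lo: "0 < lo"
    and t: "\<And>e. e \<in> edges d \<Longrightarrow> lo \<le> t e \<and> t e \<le> hi"
    and path: "is_path d (origin d) (ne1 d n) r"
    and short: "path_time t r \<le> n * hi"
  shows "(\<Sum>k<n. passage_time d (\<lambda>e. t (dup_layer (int k) e)) (origin d) (ne1 d (n - 1)))
    + n * (lo * (1 - (hi - lo)\<^sup>2 / lo\<^sup>2)) \<le> n * path_time t r"
proof -
  define L where "L = length r - 1"
  define T where "T k = passage_time d (\<lambda>e. t (dup_layer (int k) e)) (origin d) (ne1 d (n - 1))" for k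
  define h where "h i = real_of_int \<bar>clamp1 n (r ! Suc i) - clamp1 n (r ! i)\<bar>" for i
  have adj: "adjacent d (r ! i) (r ! Suc i)" if "i < L" for i
    using path_edge[OF path] that by (simp add: L_def)
  have lohi: "lo \<le> hi"
    using t[OF edge_of_adjacent[OF path_edge[OF straight_path[OF d, of 1], of 0]]] by simp
  have T_le: "T k \<le> (\<Sum>i<L. t {r ! i, r ! Suc i} + collapse_cost lo hi (int k) (r ! i) (r ! Suc i))"
    if k: "k < n" for k
  proof -
    \<comment> \<open>The range \<open>0 \<le> k < n\<close> keeps the origin fixed and moves the
      endpoint back by exactly one.\<close>
    have ends: "collapse (int k) (origin d) = origin d" "collapse (int k) (ne1 d n) = ne1 d (n - 1)"
      using d k by (auto simp: collapse_def origin_def ne1_def of_nat_diff)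
    obtain r' where r': "is_path d (origin d) (ne1 d (n - 1)) r'"
      "path_time (\<lambda>e. t (dup_layer (int k) e)) r'
        \<le> (\<Sum>i<L. t {r ! i, r ! Suc i} + collapse_cost lo hi (int k) (r ! i) (r ! Suc i))"
      using path_image[where f = "collapse (int k)" and t = "\<lambda>e. t (dup_layer (int k) e)"
          and w = "\<lambda>x y. t {x, y} + collapse_cost lo hi (int k) x y",
          OF collapse_step[where t = t] path] t
      unfolding ends L_def by blast
    have "0 \<le> t (dup_layer (int k) e)" if "e \<in> edges d" for e
      using t[OF dup_layer_edges[OF that, of "int k"]] lo by linarith
    from passage_time_le[OF r'(1), of "\<lambda>e. t (dup_layer (int k) e)", OF this] r'(2)
    show ?thesis unfolding T_def by linarith
  qed
  have "(\<Sum>k<n. T k)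
      \<le> (\<Sum>k<n. \<Sum>i<L. t {r ! i, r ! Suc i} + collapse_cost lo hi (int k) (r ! i) (r ! Suc i))"
    by (intro sum_mono T_le) simp
  also have "\<dots> = n * path_time t r + (\<Sum>i<L. \<Sum>k<n. collapse_cost lo hi (int k) (r ! i) (r ! Suc i))"
    unfolding path_time_def L_def[symmetric] sum.distrib
    by (subst (2) sum.swap) (simp add: sum_distrib_left)
  also have "(\<Sum>i<L. \<Sum>k<n. collapse_cost lo hi (int k) (r ! i) (r ! Suc i))
      \<le> (\<Sum>i<L. (hi - lo) - hi * h i)"
    unfolding h_def using lo lohi by (intro sum_mono sum_collapse_cost_le[OF adj]) auto
  also have "\<dots> = L * (hi - lo) - hi * (\<Sum>i<L. h i)"
    by (simp add: sum_subtractf sum_distrib_left)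
  finally have 1: "(\<Sum>k<n. T k) \<le> n * path_time t r + (L * (hi - lo) - hi * (\<Sum>i<L. h i))"
    by simp
  have ends: "r ! 0 = origin d" "r ! L = ne1 d n"
    using path unfolding is_path_def L_def by (auto simp: hd_conv_nth last_conv_nth)
  \<comment> \<open>The clamped coordinate is 0 at the start and \<open>n\<close> at the end of the
    path.\<close>
  have "real n = (\<Sum>i<L. real_of_int (clamp1 n (r ! Suc i)) - real_of_int (clamp1 n (r ! i)))"
    using sum_lessThan_telescope[of "\<lambda>i. real_of_int (clamp1 n (r ! i))" L] d
    by (simp add: ends clamp1_def origin_def ne1_def)
  also have "\<dots> \<le> (\<Sum>i<L. h i)"
    unfolding h_def by (intro sum_mono) simp
  finally have 2: "real n \<le> (\<Sum>i<L. h i)" .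
  \<comment> \<open>Each step takes at least \<open>lo\<close>, so the assumption
    \<open>short\<close> bounds the number of steps.\<close>
  have "L * lo \<le> path_time t r"
    unfolding path_time_def L_def[symmetric]
    using sum_mono[of "{..<L}" "\<lambda>_. lo" "\<lambda>i. t {r ! i, r ! Suc i}"] t edge_of_adjacent[OF adj] by simp
  with short have "L * lo \<le> n * hi" by linarith
  then have "L \<le> n * hi / lo" using lo by (simp add: field_simps)
  then have "L * (hi - lo) \<le> n * hi / lo * (hi - lo)"
    using lohi by (intro mult_right_mono) auto
  moreover have "hi * n \<le> hi * (\<Sum>i<L. h i)"
    using 2 lo lohi by (intro mult_left_mono) auto
  ultimately have "(\<Sum>k<n. T k) \<le> n * path_time t r + (n * hi / lo * (hi - lo) - hi * n)"
    using 1 by linarith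
  \<comment> \<open>This rests on
    \<open>hi * (hi - 2 * lo) = (hi - lo)\<^sup>2 - lo\<^sup>2\<close>.\<close>
  also have "n * hi / lo * (hi - lo) - hi * n = - (n * (lo * (1 - (hi - lo)\<^sup>2 / lo\<^sup>2)))"
    using lo by (simp add: field_simps power2_eq_square)
  finally show ?thesis unfolding T_def by simp
qed

text \<open>The left side does not depend on the path, so the bound for single paths passes to the
  infimum once it is known for slow paths too.\<close>

lemma collapsed_passage_times_le_passage_time:
  assumes d: "0 < d" and lo: "0 < lo" and n: "0 < n"
    and t: "\<And>e. e \<in> edges d \<Longrightarrow> lo \<le> t e \<and> t e \<le> hi"
  shows "(\<Sum>k<n. passage_time d (\<lambda>e. t (dup_layer (int k) e)) (origin d) (ne1 d (n - 1)))
    + n * (lo * (1 - (hi - lo)\<^sup>2 / lo\<^sup>2)) \<le> n * passage_time d t (origin d) (ne1 d n)"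
    (is "?A \<le> _")
proof -
  note sp = straight_path[OF d, of n]
  have "path_time t (map (ne1 d) [0..<Suc n]) \<le> n * hi"
    using straight_path_time_le[OF d, of t hi n] t by blast
  note s = this collapsed_passage_times_le[OF d lo t sp this]
  have "?A / n \<le> path_time t r" if "is_path d (origin d) (ne1 d n) r" for r
  proof (cases "path_time t r \<le> n * hi")
    case True
    from collapsed_passage_times_le[OF d lo t that this] show ?thesis
      using n by (simp add: field_simps)
  next
    \<comment> \<open>A path slower than \<open>n * hi\<close> is also slower than the straight one,
      for which the bound is already known.\<close>
    case False
    then have "n * path_time t (map (ne1 d) [0..<Suc n]) \<le> n * path_time t r"
      using s(1) by (intro mult_left_mono) auto
    then have "?A \<le> n * path_time t r" using s(2) by linarith
    then show ?thesis using n by (simp add: field_simps)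
  qed
  then have "?A / n \<le> passage_time d t (origin d) (ne1 d n)"
    unfolding passage_time_def using sp by (intro cInf_greatest) auto
  then show ?thesis using n by (simp add: field_simps)
qed

section \<open>Support, measurability and joint law\<close>

text \<open>A point outside the support has a null neighbourhood, hence lies in a null interval with
  rational endpoints; there are only countably many of these.\<close>

lemma AE_real_support:
  assumes "prob_space mu" "sets mu = sets borel"
  shows "AE x in mu. x \<in> real_support mu"
proof -
  interpret prob_space mu by fact
  let ?N = "{(p, q) \<in> \<rat> \<times> \<rat>. measure mu {p<..<q} = 0}"
  have "countable ?N"
    by (rule countable_subset[of _ "\<rat> \<times> \<rat>"]) (auto simp: countable_rat)
  moreover have "AE x in mu. x \<notin> {fst z<..<snd z}" if "z \<in> ?N" for z
  proof (rule AE_not_in)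
    show "{fst z<..<snd z} \<in> null_sets mu"
      using that assms(2) by (auto simp: null_sets_def emeasure_eq_measure)
  qed
  ultimately have "AE x in mu. \<forall>z\<in>?N. x \<notin> {fst z<..<snd z}"
    by (subst AE_ball_countable) auto
  then show ?thesis
  proof eventually_elim
    case (elim x)
    show ?case
    proof (rule ccontr)
      assume "x \<notin> real_support mu"
      then obtain \<epsilon> where \<epsilon>: "\<epsilon> > 0" "measure mu {x - \<epsilon> <..< x + \<epsilon>} = 0"
        unfolding real_support_def by (auto simp: not_less measure_le_0_iff)
      obtain p q where pq: "p \<in> \<rat>" "q \<in> \<rat>" "x - \<epsilon> < p" "p < x" "x < q" "q < x + \<epsilon>"
        using Rats_dense_in_real[of "x - \<epsilon>" x] Rats_dense_in_real[of x "x + \<epsilon>"] \<epsilon>(1) by auto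
      have "measure mu {p<..<q} \<le> measure mu {x - \<epsilon> <..< x + \<epsilon>}"
        using pq assms(2) by (intro finite_measure_mono) auto
      then have "(p, q) \<in> ?N" using pq \<epsilon>(2) by (simp add: measure_le_0_iff)
      then show False using elim pq by force
    qed
  qed
qed

text \<open>
  The absolute value keeps the infimum bounded below on the whole product space.
\<close>

lemma borel_measurable_passage_time_abs:
  "(\<lambda>t. passage_time d (\<lambda>e. \<bar>t e\<bar>) a b) \<in> borel_measurable (PiM (edges d) (\<lambda>_. borel))"
proof -
  have path: "(\<lambda>t. path_time (\<lambda>e. \<bar>t e\<bar>) r) \<in> borel_measurable (PiM (edges d) (\<lambda>_. borel))"
    if "is_path d a b r" for r
    unfolding path_time_def
    by (intro borel_measurable_sum borel_measurable_abs measurable_component_singleton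
        edge_of_adjacent path_edge[OF that]) auto
  have "(\<lambda>t. INF r\<in>{r. is_path d a b r}. path_time (\<lambda>e. \<bar>t e\<bar>) r)
      \<in> borel_measurable (PiM (edges d) (\<lambda>_. borel))"
  \<comment> \<open>The infimum is countable: paths are lists of integer lists.\<close>
  proof (rule borel_measurable_cINF)
    show "bdd_below ((\<lambda>r. path_time (\<lambda>e. \<bar>t e\<bar>) r) ` {r. is_path d a b r})" for t
      by (rule bdd_belowI[of _ 0]) (auto intro: path_time_nonneg)
  qed (use path in auto)
  moreover have "{path_time t r |r. is_path d a b r} = path_time t ` {r. is_path d a b r}" for t
    by auto
  ultimately show ?thesis unfolding passage_time_def by simp
qed

lemma (in prob_space) iid_reindex:
  fixes X :: "'i \<Rightarrow> 'a \<Rightarrow> real"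
  assumes indep: "indep_vars (\<lambda>_. borel) X I"
    and law: "\<And>i. i \<in> I \<Longrightarrow> distr M borel (X i) = mu"
    and f: "inj_on f I" "f ` I \<subseteq> I"
  shows "distr M (PiM I (\<lambda>_. borel)) (\<lambda>\<omega>. \<lambda>i\<in>I. X (f i) \<omega>)
    = distr M (PiM I (\<lambda>_. borel)) (\<lambda>\<omega>. \<lambda>i\<in>I. X i \<omega>)"
proof (cases "I = {}")
  case True
  then show ?thesis by (simp add: restrict_def)
next
  case False
  define P where "P = PiM I (\<lambda>_. borel :: real measure)"
  define Q where "Q = PiM I (\<lambda>_. mu)"
  have rv: "random_variable borel (X i)" if "i \<in> I" for i
    using indep that unfolding indep_vars_def by auto
  obtain j where "j \<in> I" using False by blast
  then have mu: "prob_space mu" "sets mu = sets borel"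
    using prob_space_distr[OF rv] law by fastforce+
  have X: "(\<lambda>\<omega>. \<lambda>i\<in>I. X i \<omega>) \<in> measurable M P"
    unfolding P_def by (rule measurable_restrict) (rule rv)
  have F: "(\<lambda>x. \<lambda>i\<in>I. x (f i)) \<in> measurable P P"
    unfolding P_def using f(2) by (intro measurable_restrict measurable_component_singleton) auto
  have "distr M P (\<lambda>\<omega>. \<lambda>i\<in>I. X i \<omega>) = PiM I (\<lambda>i. distr M borel (X i))"
    using indep_vars_iff_distr_eq_PiM'[OF False rv] indep unfolding P_def by simp
  also have "\<dots> = Q"
    unfolding Q_def using law by (intro PiM_cong) auto
  finally have XQ: "distr M P (\<lambda>\<omega>. \<lambda>i\<in>I. X i \<omega>) = Q" .
  \<comment> \<open>\<open>P\<close> only supplies the Borel product sigma-algebra, while reindexing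
    is applied to the measure \<open>Q\<close>; equal sets allow the target to be exchanged.\<close>
  have "sets Q = sets P"
    unfolding Q_def P_def by (intro sets_PiM_cong) (use mu in auto)
  then have "distr Q P (\<lambda>x. \<lambda>i\<in>I. x (f i)) = distr Q Q (\<lambda>x. \<lambda>i\<in>I. x (f i))"
    by (intro distr_cong) auto
  also have "\<dots> = Q"
    unfolding Q_def using f mu by (intro distr_PiM_reindex) auto
  finally have "Q = distr M P ((\<lambda>x. \<lambda>i\<in>I. x (f i)) \<circ> (\<lambda>\<omega>. \<lambda>i\<in>I. X i \<omega>))"
    unfolding XQ[symmetric] distr_distr[OF F X] by simp
  also have "(\<lambda>x. \<lambda>i\<in>I. x (f i)) \<circ> (\<lambda>\<omega>. \<lambda>i\<in>I. X i \<omega>) = (\<lambda>\<omega>. \<lambda>i\<in>I. X (f i) \<omega>)"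
    using f(2) by (auto simp: fun_eq_iff restrict_def image_subset_iff)
  finally show ?thesis unfolding XQ[unfolded P_def] unfolding P_def by (rule sym)
qed

section \<open>Passing to expectations\<close>

theorem theorem1:
  fixes M :: "'a measure" and d :: nat
    and tau :: "int list set \<Rightarrow> 'a \<Rightarrow> real" and mu :: "real measure"
  assumes "prob_space M"
    and "d \<ge> 2"
    and "\<And>e. e \<in> edges d \<Longrightarrow> tau e \<in> borel_measurable M"
    and "prob_space.indep_vars M (\<lambda>_. borel) tau (edges d)"
    and "\<And>e. e \<in> edges d \<Longrightarrow> distr M borel (tau e) = mu"
    and "\<And>e \<omega>. e \<in> edges d \<Longrightarrow> \<omega> \<in> space M \<Longrightarrow> tau e \<omega> \<ge> 0"
    and "0 < Inf (real_support mu)"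
    and "bdd_above (real_support mu)"
    and "Sup (real_support mu) \<le> 2 * Inf (real_support mu)"
  shows "\<forall>n\<ge>1. mean_time M d tau n \<ge> mean_time M d tau (n - 1)
            + Inf (real_support mu) * (1 - (Sup (real_support mu) - Inf (real_support mu))^2
                                         / (Inf (real_support mu))^2)"
proof (intro allI impI)
  fix n :: nat assume "1 \<le> n"
  then have n: "0 < n" by simp
  interpret prob_space M by fact
  note meas = assms(3) and indep = assms(4) and law = assms(5) and nonneg = assms(6)
  have d: "0 < d" using assms(2) by simp
  define lo where "lo = Inf (real_support mu)"
  define hi where "hi = Sup (real_support mu)"
  have lo: "0 < lo" using assms(7) by (simp add: lo_def)

  obtain e0 where e0: "e0 \<in> edges d"
    using edge_of_adjacent[OF path_edge[OF straight_path[OF d, of 1], of 0]] by auto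
  have mu: "prob_space mu" "sets mu = sets borel"
    unfolding law[OF e0, symmetric] using prob_space_distr[OF meas[OF e0]] by auto
  \<comment> \<open>A negative support point \<open>x\<close> would give positive mass to the
    interval from \<open>2 * x\<close> to 0, against non-negativity of the times. So the support is
    bounded below and \<open>lo\<close> is a genuine lower bound.\<close>
  have supp_nonneg: "0 \<le> x" if "x \<in> real_support mu" for x
  proof (rule ccontr)
    assume "\<not> 0 \<le> x"
    moreover have "\<forall>\<epsilon>>0. measure mu {x - \<epsilon> <..< x + \<epsilon>} > 0"
      using that unfolding real_support_def by blast
    ultimately have "measure mu {x - (- x) <..< x + (- x)} > 0"
      by (metis neg_0_less_iff_less not_le)
    moreover have "measure mu {x - (- x) <..< x + (- x)}
        = prob (tau e0 -` {x - (- x) <..< x + (- x)} \<inter> space M)"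
      unfolding law[OF e0, symmetric] using meas[OF e0] by (rule measure_distr) simp
    moreover have "tau e0 -` {x - (- x) <..< x + (- x)} \<inter> space M = {}"
      using nonneg[OF e0] by force
    ultimately show False
      by simp
  qed
  have AE_bounds: "AE \<omega> in M. \<forall>e\<in>edges d. lo \<le> tau e \<omega> \<and> tau e \<omega> \<le> hi"
  proof (subst AE_ball_countable[OF countable_edges], rule ballI)
    fix e assume e: "e \<in> edges d"
    have "AE x in mu. lo \<le> x \<and> x \<le> hi"
      using AE_real_support[OF mu]
    proof eventually_elim
      case (elim x)
      have "bdd_below (real_support mu)" using supp_nonneg by (rule bdd_belowI)
      then show ?case
        unfolding lo_def hi_def using elim assms(8) by (auto intro: cInf_lower cSup_upper)
    qed
    then show "AE \<omega> in M. lo \<le> tau e \<omega> \<and> tau e \<omega> \<le> hi"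
      unfolding law[OF e, symmetric] using meas[OF e] by (subst (asm) AE_distr_iff) auto
  qed

  \<comment> \<open>\<open>T\<close> reads the environment through \<open>f\<close>:
    \<open>id\<close> gives the original one and \<open>dup_layer k\<close> the glued one.
    \<open>F\<close> is a measurable functional of the whole environment that agrees with
    \<open>T\<close> because the times are non-negative.\<close>
  define T where "T f m \<omega> = passage_time d (\<lambda>e. tau (f e) \<omega>) (origin d) (ne1 d m)" for f m \<omega>
  define F where "F m t = passage_time d (\<lambda>e. \<bar>t e\<bar>) (origin d) (ne1 d m)"
    for m and t :: "int list set \<Rightarrow> real"
  have F_meas: "F m \<in> borel_measurable (PiM (edges d) (\<lambda>_. borel))" for m
    unfolding F_def by (rule borel_measurable_passage_time_abs)
  have T_eq: "T f m \<omega> = F m (\<lambda>e\<in>edges d. tau (f e) \<omega>)"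
    if "f ` edges d \<subseteq> edges d" "\<omega> \<in> space M" for f m \<omega>
    unfolding T_def F_def by (rule passage_time_cong) (use that nonneg in auto)
  have R_meas: "(\<lambda>\<omega>. \<lambda>e\<in>edges d. tau (f e) \<omega>) \<in> measurable M (PiM (edges d) (\<lambda>_. borel))"
    if "f ` edges d \<subseteq> edges d" for f
    by (rule measurable_restrict) (use that meas in auto)
  have T_int: "integrable M (T f m)" if f: "f ` edges d \<subseteq> edges d" for f m
  proof (rule integrable_const_bound[of _ "m * hi"])
    show "AE \<omega> in M. norm (T f m \<omega>) \<le> m * hi"
      using AE_bounds
    proof eventually_elim
      case (elim \<omega>)
      then have "0 \<le> tau (f e) \<omega> \<and> tau (f e) \<omega> \<le> hi" if "e \<in> edges d" for e
        using f that lo by (smt (verit) image_subset_iff)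
      from passage_time_bounds[OF d, of "\<lambda>e. tau (f e) \<omega>", OF this] show ?case
        unfolding T_def by simp
    qed
    have "(\<lambda>\<omega>. F m (\<lambda>e\<in>edges d. tau (f e) \<omega>)) \<in> borel_measurable M"
      using measurable_compose[OF R_meas[OF f] F_meas] .
    then show "T f m \<in> borel_measurable M"
      by (subst measurable_cong[OF T_eq[OF f]])
  qed
  \<comment> \<open>Both expectations are integrals of the same \<open>F m\<close> against the joint
    law of the times read, and this law is the same for \<open>f\<close> and
    \<open>id\<close>.\<close>
  have T_exp: "expectation (T f m) = mean_time M d tau m"
    if f: "inj_on f (edges d)" "f ` edges d \<subseteq> edges d" for f m
  proof -
    have id: "id ` edges d \<subseteq> edges d" by simp
    have *: "expectation (T g m) = (\<integral>t. F m t \<partial>distr M (PiM (edges d) (\<lambda>_. borel))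
        (\<lambda>\<omega>. \<lambda>e\<in>edges d. tau (g e) \<omega>))" if "g ` edges d \<subseteq> edges d" for g
      by (subst integral_distr[OF R_meas[OF that] F_meas])
        (use T_eq[OF that] in \<open>auto intro: Bochner_Integration.integral_cong\<close>)
    have "distr M (PiM (edges d) (\<lambda>_. borel)) (\<lambda>\<omega>. \<lambda>e\<in>edges d. tau (f e) \<omega>)
        = distr M (PiM (edges d) (\<lambda>_. borel)) (\<lambda>\<omega>. \<lambda>e\<in>edges d. tau e \<omega>)"
      by (rule iid_reindex[OF indep law f])
    then have "expectation (T f m) = expectation (T id m)"
      unfolding *[OF f(2)] *[OF id] by simp
    moreover have "T id m = (\<lambda>\<omega>. passage_time d (\<lambda>e. tau e \<omega>) (origin d) (ne1 d m))"
      by (simp add: T_def fun_eq_iff)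
    ultimately show ?thesis by (simp add: mean_time_def)
  qed

  define c where "c = lo * (1 - (hi - lo)\<^sup>2 / lo\<^sup>2)"
  have dup: "dup_layer k ` edges d \<subseteq> edges d" for k
    using dup_layer_edges by auto
  have ints: "integrable M (T id n)" "integrable M (T (dup_layer k) (n - 1))" for k
    using T_int dup by auto
  have "AE \<omega> in M. (\<Sum>k<n. T (dup_layer (int k)) (n - 1) \<omega>) + n * c \<le> n * T id n \<omega>"
    using AE_bounds
  proof eventually_elim
    case (elim \<omega>)
    then show ?case
      unfolding T_def c_def
      using collapsed_passage_times_le_passage_time[OF d lo n, of "\<lambda>e. tau e \<omega>" hi] by simp
  qed
  \<comment> \<open>After integration all \<open>n\<close> summands equal the mean time to
    \<open>n - 1\<close>, so a factor \<open>n\<close> cancels.\<close>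
  then have "expectation (\<lambda>\<omega>. (\<Sum>k<n. T (dup_layer (int k)) (n - 1) \<omega>) + n * c)
      \<le> expectation (\<lambda>\<omega>. n * T id n \<omega>)"
    using ints by (intro integral_mono_AE) auto
  also have "expectation (\<lambda>\<omega>. (\<Sum>k<n. T (dup_layer (int k)) (n - 1) \<omega>) + n * c)
      = n * mean_time M d tau (n - 1) + n * c"
    using ints T_exp[OF inj_on_dup_layer dup] by (simp add: prob_space)
  also have "expectation (\<lambda>\<omega>. n * T id n \<omega>) = n * mean_time M d tau n"
    using T_exp[of id n] by simp
  finally have "n * (mean_time M d tau (n - 1) + c) \<le> n * mean_time M d tau n"
    by (simp add: algebra_simps)
  then show "mean_time M d tau (n - 1)
      + Inf (real_support mu) * (1 - (Sup (real_support mu) - Inf (real_support mu))^2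
                                   / (Inf (real_support mu))^2) \<le> mean_time M d tau n"
    using n by (simp add: c_def lo_def hi_def)
qed

end
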